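(* For integers $m\ge1$ and $n\ge1$ with $m+n\ge3$ we have $$\mathrm{QEC}(K_n\star K_m)=-\frac{1}{1+\sqrt{\left(1-\frac1m\right)\left(1-\frac1n\right)}}\,.$$
   Context: $K_n$ is the complete graph on $n$ vertices. The star product $K_n\star K_m$ is the graph obtained by joining $K_n$ and $K_m$ at a single vertex: its vertex set is $\{1,2,\dots,n+m-1\}$ and its edge set is $\{\{i,j\}:1\le i<j\le n\}\cup\{\{i,j\}:n\le i<j\le n+m-1\}$. For a finite connected graph $G=(V,E)$ with $|V|\ge2$, $d(i,j)$ denotes the length of a shortest walk connecting $i$ and $j$ (with $d(i,i)=0$), and $D=[d(i,j)]_{i,j\in V}$ is the distance matrix. $C(V)$ is the space of real-valued functions on $V$, $\langle\cdot,\cdot\rangle$ its canonical inner product, and $\mathbf 1$ the constant function with value $1$. The quadratic embedding constant of $G$ is $$\mathrm{QEC}(G)=\max\{\langle f,Df\rangle : f\in C(V),\ \langle f,f\rangle=1,\ \langle \mathbf 1,f\rangle=0\}.$$ *)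

theory Defs
  imports "Graph_Theory.Graph_Theory" Complex_Main
begin

text \<open>As in the AFP entry \<open>Graph_Theory\<close>, an undirected graph is a symmetric digraph; walks are
  the arc walks of that entry. If no walk exists, the value of \<open>graph_dist\<close> is arbitrary; all graphs
  of interest are connected.\<close>

definition graph_dist :: "('a, 'b) pre_digraph \<Rightarrow> 'a \<Rightarrow> 'a \<Rightarrow> nat" where
  "graph_dist G u v = (LEAST k. \<exists>p. pre_digraph.awalk G u p v \<and> length p = k)"

definition dist_matrix :: "('a, 'b) pre_digraph \<Rightarrow> 'a \<Rightarrow> 'a \<Rightarrow> real" where
  "dist_matrix G u v = real (graph_dist G u v)"

definition mat_apply :: "'a set \<Rightarrow> ('a \<Rightarrow> 'a \<Rightarrow> real) \<Rightarrow> ('a \<Rightarrow> real) \<Rightarrow> 'a \<Rightarrow> real" where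
  "mat_apply V A f = (\<lambda>u. \<Sum>v\<in>V. A u v * f v)"

text \<open>A function on the vertex set \<open>V\<close> is represented by a total function; all the sums below
  range over \<open>V\<close>, so its values outside \<open>V\<close> play no role.\<close>

definition inner_on :: "'a set \<Rightarrow> ('a \<Rightarrow> real) \<Rightarrow> ('a \<Rightarrow> real) \<Rightarrow> real" where
  "inner_on V f g = (\<Sum>v\<in>V. f v * g v)"

text \<open>The set of values is infinite in general, so \<open>Max\<close> (which is for finite sets) is not
  applicable; \<open>GREATEST\<close> denotes the largest element, which has to be attained.\<close>

definition QEC :: "('a, 'b) pre_digraph \<Rightarrow> real" where
  "QEC G = (GREATEST x. x \<in> {inner_on (verts G) f (mat_apply (verts G) (dist_matrix G) f) | f.
      inner_on (verts G) f f = 1 \<and> inner_on (verts G) (\<lambda>_. 1) f = 0})"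

definition star_edges :: "nat \<Rightarrow> nat \<Rightarrow> nat set set" where
  "star_edges n m = {{i, j} | i j. 1 \<le> i \<and> i < j \<and> j \<le> n}
                  \<union> {{i, j} | i j. n \<le> i \<and> i < j \<and> j \<le> n + m - 1}"

definition complete_star :: "nat \<Rightarrow> nat \<Rightarrow> nat pair_pre_digraph" where
  "complete_star n m = \<lparr> pverts = {1..n + m - 1}, parcs = {(i, j). {i, j} \<in> star_edges n m} \<rparr>"

lemma parcs_complete_star_iff:
  "(i, j) \<in> parcs (complete_star n m) \<longleftrightarrow>
     i \<noteq> j \<and> (i \<in> {1..n} \<and> j \<in> {1..n} \<or> i \<in> {n..n + m - 1} \<and> j \<in> {n..n + m - 1})"
  unfolding complete_star_def star_edges_def
  by (cases i j rule: linorder_cases) (auto simp: doubleton_eq_iff)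

lemma pair_graph_complete_star:
  assumes "n \<ge> 1" and "m \<ge> 1"
  shows "pair_graph (complete_star n m)"
proof
  show "finite (parcs (complete_star n m))"
    by (rule finite_subset[of _ "{..n + m} \<times> {..n + m}"])
      (auto simp: parcs_complete_star_iff)
  show "symmetric (with_proj (complete_star n m))"
    by (auto simp: symmetric_def parcs_complete_star_iff intro!: symI)
qed (use assms in \<open>auto simp: parcs_complete_star_iff complete_star_def[THEN arg_cong[of _ _ pverts]]\<close>)

lemma card_complete_star: "card (pverts (complete_star n m)) = n + m - 1"
  by (simp add: complete_star_def)

lemma connected_complete_star:
  assumes "n \<ge> 1" and "m \<ge> 1"
  shows "Digraph_Component.connected (with_proj (complete_star n m))"
proof -
  let ?G = "with_proj (complete_star n m)"
  interpret pair_graph "complete_star n m"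
    by (rule pair_graph_complete_star[OF assms])
  have n: "n \<in> verts ?G"
    using assms by (simp add: complete_star_def)
  have hub: "u \<rightarrow>\<^sup>*\<^bsub>?G\<^esub> n \<and> n \<rightarrow>\<^sup>*\<^bsub>?G\<^esub> u" if "u \<in> verts ?G" for u
  proof (cases "u = n")
    case True
    then show ?thesis using n by auto
  next
    case False
    then have "(u, n) \<in> parcs (complete_star n m)" "(n, u) \<in> parcs (complete_star n m)"
      using that assms unfolding parcs_complete_star_iff by (auto simp: complete_star_def)
    then show ?thesis by (auto intro!: reachable_adjI)
  qed
  have "strongly_connected ?G"
    using hub n reachable_trans by (intro strongly_connectedI) blast+
  moreover have "parcs (mk_symmetric ?G) = parcs (complete_star n m)"
    unfolding mk_symmetric_def by (auto simp: parcs_complete_star_iff)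
  then have "mk_symmetric ?G = complete_star n m"
    by (simp add: mk_symmetric_def)
  ultimately show ?thesis
    by (simp add: connected_def)
qed

end

theory Submission
  imports Defs "HOL-Analysis.Convex"
begin

text \<open>
  Vertices in different blocks of the star are at distance two and all other distinct vertices are
  at distance one. The distance matrix is therefore the all-ones matrix minus the identity plus the
  indicator of the pairs of vertices that lie in different blocks. If \<open>f\<close> sums to zero and
  \<open>x\<close>, \<open>y\<close> denote its sums over the two blocks without the hub, this gives
  \<open>\<langle>f, D f\<rangle> = - \<langle>f, f\<rangle> + 2 x y\<close> (\<open>form_complete_star\<close>), and \<open>f\<close> takes the value \<open>- (x + y)\<close>
  at the hub.

  Let \<open>P\<close> and \<open>Q\<close> be the sums of squares of \<open>f\<close> over the two blocks without the hub, so that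
  \<open>\<langle>f, f\<rangle> = P + Q + (x + y)\<^sup>2\<close>, and let \<open>t = sqrt ((1 - 1/m) (1 - 1/n))\<close>. The first block has
  \<open>n - 1\<close> vertices besides the hub, so Cauchy--Schwarz yields \<open>x\<^sup>2 \<le> (n - 1) P\<close>, which can be
  rewritten as \<open>x\<^sup>2 \<le> (1 - 1/n) (P + x\<^sup>2)\<close>; likewise for \<open>y\<close>. Multiplying both and applying the
  inequality of arithmetic and geometric means gives
  \<open>2 x y \<le> t (P + x\<^sup>2 + Q + y\<^sup>2) = t (\<langle>f, f\<rangle> - 2 x y)\<close>. Solving for \<open>2 x y\<close> bounds the form by
  \<open>- \<langle>f, f\<rangle> / (1 + t)\<close> (\<open>star_product_bound\<close>). For \<open>m, n \<ge> 2\<close> equality holds for a function that is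
  constant on each block without the hub, with both constants positive and scaled so that
  \<open>P + x\<^sup>2 = Q + y\<^sup>2\<close> (\<open>block_profile\<close>). If \<open>m = 1\<close> or \<open>n = 1\<close>, then \<open>t = x y = 0\<close> and every \<open>f\<close>
  that sums to zero gives equality.
\<close>

section \<open>Quadratic embedding constants from Rayleigh quotients\<close>

text \<open>Both sides are homogeneous of degree two in \<open>f\<close>, so neither the bound nor the extremal
  function has to be normalised.\<close>

lemma QEC_eqI:
  assumes bound: "\<And>f. inner_on (verts G) (\<lambda>_. 1) f = 0 \<Longrightarrow>
      inner_on (verts G) f (mat_apply (verts G) (dist_matrix G) f) \<le> c * inner_on (verts G) f f"
    and sum0: "inner_on (verts G) (\<lambda>_. 1) g = 0"
    and pos: "inner_on (verts G) g g > 0"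
    and attained: "inner_on (verts G) g (mat_apply (verts G) (dist_matrix G) g)
      = c * inner_on (verts G) g g"
  shows "QEC G = c"
  unfolding QEC_def
proof (rule Greatest_equality)
  define r where "r = 1 / sqrt (inner_on (verts G) g g)"
  define h where "h = (\<lambda>v. r * g v)"
  have r2: "r * r * inner_on (verts G) g g = 1"
    using pos by (simp add: r_def)
  have norm: "inner_on (verts G) h h = 1"
    using r2 by (simp add: inner_on_def h_def sum_distrib_left algebra_simps)
  have sum: "inner_on (verts G) (\<lambda>_. 1) h = 0"
    using sum0 by (simp add: inner_on_def h_def flip: sum_distrib_left)
  have "inner_on (verts G) h (mat_apply (verts G) (dist_matrix G) h)
      = r * r * inner_on (verts G) g (mat_apply (verts G) (dist_matrix G) g)"
    by (simp add: inner_on_def mat_apply_def h_def sum_distrib_left algebra_simps)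
  also have "\<dots> = c"
    using r2 by (simp add: attained algebra_simps)
  finally show "c \<in> {inner_on (verts G) f (mat_apply (verts G) (dist_matrix G) f) | f.
      inner_on (verts G) f f = 1 \<and> inner_on (verts G) (\<lambda>_. 1) f = 0}"
    using norm sum by force
next
  fix y
  assume "y \<in> {inner_on (verts G) f (mat_apply (verts G) (dist_matrix G) f) | f.
      inner_on (verts G) f f = 1 \<and> inner_on (verts G) (\<lambda>_. 1) f = 0}"
  then show "c \<ge> y"
    using bound by fastforce
qed

section \<open>Distances and the distance form of the star product\<close>

context pair_wf_digraph
begin

lemma graph_dist_self:
  assumes "u \<in> pverts G"
  shows "graph_dist (with_proj G) u u = 0"
  unfolding graph_dist_def
  by (rule Least_equality) (use assms in \<open>auto simp: awalk_def\<close>)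

lemma graph_dist_adjacent:
  assumes "(u, v) \<in> parcs G" and "u \<noteq> v"
  shows "graph_dist (with_proj G) u v = 1"
  unfolding graph_dist_def
proof (rule Least_equality)
  have "awalk u [(u, v)] v"
    using assms in_arcsD1 by (auto simp: awalk_def)
  then show "\<exists>p. awalk u p v \<and> length p = 1"
    by (intro exI[of _ "[(u, v)]"]) simp
next
  fix k
  assume "\<exists>p. awalk u p v \<and> length p = k"
  then show "1 \<le> k"
    using assms by (cases k) (auto simp: awalk_def)
qed

lemma graph_dist_common_neighbour:
  assumes "(u, w) \<in> parcs G" and "(w, v) \<in> parcs G" and "(u, v) \<notin> parcs G" and "u \<noteq> v"
  shows "graph_dist (with_proj G) u v = 2"
  unfolding graph_dist_def
proof (rule Least_equality)
  have "awalk u [(u, w), (w, v)] v"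
    using assms in_arcsD1 by (auto simp: awalk_def)
  then show "\<exists>p. awalk u p v \<and> length p = 2"
    by (intro exI[of _ "[(u, w), (w, v)]"]) simp
next
  fix k
  assume "\<exists>p. awalk u p v \<and> length p = k"
  then obtain p where p: "awalk u p v" "length p = k"
    by blast
  have "p \<noteq> []" and "p \<noteq> [e]" for e
    using p assms by (cases e; auto simp: awalk_def)+
  then show "2 \<le> k"
    using p by (cases p; cases "tl p") auto
qed

end

text \<open>The matrix is written as \<open>J - I\<close> plus the two off-diagonal blocks, a form in which each
  summand can be applied to a function separately.\<close>

lemma dist_matrix_complete_star:
  assumes "m \<ge> 1" and "n \<ge> 1" and u: "u \<in> {1..n + m - 1}" and v: "v \<in> {1..n + m - 1}"
  shows "dist_matrix (with_proj (complete_star n m)) u v =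
    1 - of_bool (v = u) + of_bool (u \<in> {1..<n}) * of_bool (v \<in> {n<..n + m - 1})
      + of_bool (u \<in> {n<..n + m - 1}) * of_bool (v \<in> {1..<n})"
proof -
  interpret pair_graph "complete_star n m"
    using assms by (intro pair_graph_complete_star)
  have verts: "pverts (complete_star n m) = {1..n + m - 1}"
    by (simp add: complete_star_def)
  consider "u = v" | "u \<noteq> v" "(u, v) \<in> parcs (complete_star n m)"
    | "u \<noteq> v" "(u, v) \<notin> parcs (complete_star n m)"
    by blast
  then show ?thesis
  proof cases
    case 1
    then show ?thesis
      using u by (auto simp: dist_matrix_def graph_dist_self verts)
  next
    case 2
    then show ?thesis
      by (auto simp: dist_matrix_def graph_dist_adjacent parcs_complete_star_iff)
  next
    case 3
    have "(u, n) \<in> parcs (complete_star n m)" "(n, v) \<in> parcs (complete_star n m)"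
      using 3 assms by (auto simp: parcs_complete_star_iff)
    then have "dist_matrix (with_proj (complete_star n m)) u v = 2"
      using 3 by (simp add: dist_matrix_def graph_dist_common_neighbour)
    then show ?thesis
      using 3 u v by (auto simp: parcs_complete_star_iff)
  qed
qed

lemma sum_of_bool_mult_subset:
  fixes f :: "'a \<Rightarrow> real"
  assumes "finite V" and "A \<subseteq> V"
  shows "(\<Sum>v\<in>V. of_bool (v \<in> A) * f v) = sum f A"
  using assms by (intro sum.mono_neutral_cong_right) auto

lemma form_complete_star:
  fixes f :: "nat \<Rightarrow> real"
  assumes "m \<ge> 1" and "n \<ge> 1"
  defines "V \<equiv> {1..n + m - 1}"
  shows "inner_on V f (mat_apply V (dist_matrix (with_proj (complete_star n m))) f) =
    (sum f V)\<^sup>2 - inner_on V f f + 2 * sum f {1..<n} * sum f {n<..n + m - 1}"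
proof -
  let ?A = "{1..<n}" and ?B = "{n<..n + m - 1}"
  have sub: "finite V" "?A \<subseteq> V" "?B \<subseteq> V"
    using assms by auto
  have row: "mat_apply V (dist_matrix (with_proj (complete_star n m))) f u =
      sum f V - f u + of_bool (u \<in> ?A) * sum f ?B + of_bool (u \<in> ?B) * sum f ?A"
    if u: "u \<in> V" for u
  proof -
    have "mat_apply V (dist_matrix (with_proj (complete_star n m))) f u =
        (\<Sum>v\<in>V. f v - of_bool (v \<in> {u}) * f v
          + of_bool (u \<in> ?A) * (of_bool (v \<in> ?B) * f v)
          + of_bool (u \<in> ?B) * (of_bool (v \<in> ?A) * f v))"
      unfolding mat_apply_def
      using u assms(1,2) unfolding V_def
      by (intro sum.cong refl) (simp add: dist_matrix_complete_star algebra_simps)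
    also have "\<dots> = sum f V - sum f {u} + of_bool (u \<in> ?A) * sum f ?B + of_bool (u \<in> ?B) * sum f ?A"
      using sub u
      by (simp only: sum.distrib sum_subtractf sum_of_bool_mult_subset insert_subset empty_subsetI
          simp_thms flip: sum_distrib_left)
    finally show ?thesis
      by simp
  qed
  have "inner_on V f (mat_apply V (dist_matrix (with_proj (complete_star n m))) f) =
      (\<Sum>u\<in>V. sum f V * f u - f u * f u + sum f ?B * (of_bool (u \<in> ?A) * f u)
        + sum f ?A * (of_bool (u \<in> ?B) * f u))"
    unfolding inner_on_def by (intro sum.cong refl) (simp add: row algebra_simps)
  also have "\<dots> = sum f V * sum f V - inner_on V f f + sum f ?B * sum f ?A + sum f ?A * sum f ?B"
    using sub
    by (simp only: sum.distrib sum_subtractf sum_of_bool_mult_subset inner_on_def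
        flip: sum_distrib_left)
  finally show ?thesis
    by (simp add: power2_eq_square)
qed

lemma sum_star_verts:
  fixes f :: "nat \<Rightarrow> real"
  assumes "m \<ge> 1" and "n \<ge> 1"
  shows "sum f {1..n + m - 1} = sum f {1..<n} + f n + sum f {n<..n + m - 1}"
proof -
  have "{1..n + m - 1} = insert n ({1..<n} \<union> {n<..n + m - 1})"
    using assms by auto
  moreover have "{1..<n} \<inter> {n<..n + m - 1} = {}"
    by auto
  ultimately show ?thesis
    by (simp add: sum.union_disjoint del: One_nat_def)
qed

section \<open>The extremal problem\<close>

text \<open>Adding \<open>(k - 1) x\<^sup>2\<close> to both sides of the Cauchy--Schwarz inequality \<open>x\<^sup>2 \<le> (k - 1) P\<close> and
  dividing by \<open>k\<close> gives a form in which the case \<open>k = 1\<close> of an empty index set is not special.\<close>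

lemma sum_squared_le_one_minus_inverse:
  fixes f :: "'a \<Rightarrow> real"
  assumes "k = card A + 1"
  shows "(sum f A)\<^sup>2 \<le> (1 - 1 / real k) * ((\<Sum>v\<in>A. (f v)\<^sup>2) + (sum f A)\<^sup>2)"
proof -
  have "(sum f A)\<^sup>2 \<le> (\<Sum>v\<in>A. (f v)\<^sup>2) * card A"
    using sum_squared_le_sum_of_squares[of f A] by simp
  moreover have "1 - 1 / real k = card A / (card A + 1)"
    using assms by (simp add: field_simps)
  ultimately show ?thesis
    by (simp add: field_simps)
qed

lemma star_product_bound:
  fixes x y P Q a b :: real
  assumes x: "x\<^sup>2 \<le> a * (P + x\<^sup>2)" and y: "y\<^sup>2 \<le> b * (Q + y\<^sup>2)"
    and nonneg: "0 \<le> a" "0 \<le> b" "0 \<le> P" "0 \<le> Q"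
  shows "2 * x * y - (P + (x + y)\<^sup>2 + Q) \<le> - (1 / (1 + sqrt (a * b))) * (P + (x + y)\<^sup>2 + Q)"
proof -
  define t where "t = sqrt (a * b)"
  have t: "0 \<le> t"
    using nonneg by (simp add: t_def)
  have "x * y \<le> sqrt (x\<^sup>2) * sqrt (y\<^sup>2)"
    by (simp flip: abs_mult)
  also have "\<dots> \<le> sqrt (a * (P + x\<^sup>2)) * sqrt (b * (Q + y\<^sup>2))"
    using x y nonneg by (intro mult_mono real_sqrt_le_mono) auto
  also have "\<dots> = t * sqrt ((P + x\<^sup>2) * (Q + y\<^sup>2))"
    by (simp add: t_def real_sqrt_mult)
  also have "\<dots> \<le> t * ((P + x\<^sup>2 + (Q + y\<^sup>2)) / 2)"
    using t nonneg by (intro mult_left_mono arith_geo_mean_sqrt) auto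
  finally have "2 * x * y \<le> t * (P + (x + y)\<^sup>2 + Q - 2 * x * y)"
    by (simp add: power2_sum algebra_simps)
  then have "(1 + t) * (2 * x * y - (P + (x + y)\<^sup>2 + Q)) \<le> - (P + (x + y)\<^sup>2 + Q)"
    by (simp add: algebra_simps)
  then show ?thesis
    using t by (simp add: t_def[symmetric] field_simps)
qed

text \<open>The value that an extremal function takes on a block of size \<open>k\<close> without its hub. For
  \<open>k \<ge> 2\<close> it is scaled so that the block sum \<open>x\<close> and the sum of squares \<open>P\<close> satisfy
  \<open>P + x\<^sup>2 = 1\<close>: two such blocks are balanced as equality of the arithmetic and geometric means
  requires. If \<open>k = 1\<close>,
  nothing but the hub is left and both sums vanish.\<close>

lemma block_profile:
  fixes k :: nat
  assumes "k \<ge> 1"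
  obtains p :: real where "real (k - 1) * p = sqrt (1 - 1 / real k)"
    and "real (k - 1) * p\<^sup>2 + (sqrt (1 - 1 / real k))\<^sup>2 = of_bool (k \<ge> 2)"
proof (cases "k = 1")
  case True
  then show ?thesis
    using that by simp
next
  case False
  define a where "a = sqrt (1 - 1 / real k)"
  have k: "real (k - 1) = real k - 1" "real k > 1"
    using assms False by auto
  have a: "a\<^sup>2 = (real k - 1) / real k"
    using k by (simp add: a_def field_simps)
  have "real (k - 1) * (a / real (k - 1))\<^sup>2 = 1 / real k"
    unfolding power_divide a using k by (simp add: power2_eq_square)
  then have "real (k - 1) * (a / real (k - 1))\<^sup>2 + a\<^sup>2 = 1"
    using k by (simp add: a field_simps)
  moreover have "real (k - 1) * (a / real (k - 1)) = a"
    using k by simp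
  ultimately show ?thesis
    using that[of "a / real (k - 1)"] False assms by (simp add: a_def)
qed

theorem proposition4p7:
  fixes m n :: nat
  assumes "m \<ge> 1" and "n \<ge> 1" and "m + n \<ge> 3"
  shows "QEC (with_proj (complete_star n m)) =
    - (1 / (1 + sqrt ((1 - 1 / real m) * (1 - 1 / real n))))"
proof -
  let ?G = "with_proj (complete_star n m)"
  define V A B where "V = {1..n + m - 1}" and "A = {1..<n}" and "B = {n<..n + m - 1}"
  have verts: "verts ?G = V"
    by (simp add: V_def complete_star_def)
  have split: "sum f V = sum f A + f n + sum f B" for f :: "nat \<Rightarrow> real"
    unfolding V_def A_def B_def by (rule sum_star_verts[OF assms(1,2)])
  have hub: "f n = - (sum f A + sum f B)" if "inner_on V (\<lambda>_. 1) f = 0" for f :: "nat \<Rightarrow> real"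
    using that by (simp add: inner_on_def split)
  have norm: "inner_on V f f = (\<Sum>v\<in>A. (f v)\<^sup>2) + (sum f A + sum f B)\<^sup>2 + (\<Sum>v\<in>B. (f v)\<^sup>2)"
    if "inner_on V (\<lambda>_. 1) f = 0" for f :: "nat \<Rightarrow> real"
    unfolding inner_on_def split hub[OF that] by (simp add: power2_eq_square algebra_simps)
  have form: "inner_on V f (mat_apply V (dist_matrix ?G) f)
      = 2 * sum f A * sum f B - inner_on V f f"
    if "inner_on V (\<lambda>_. 1) f = 0" for f :: "nat \<Rightarrow> real"
    using form_complete_star[OF assms(1,2), of f] that
    by (simp add: inner_on_def V_def A_def B_def)
  obtain p where p: "real (n - 1) * p = sqrt (1 - 1 / real n)"
      "real (n - 1) * p\<^sup>2 + (sqrt (1 - 1 / real n))\<^sup>2 = of_bool (n \<ge> 2)"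
    using block_profile[OF assms(2)] by blast
  obtain q where q: "real (m - 1) * q = sqrt (1 - 1 / real m)"
      "real (m - 1) * q\<^sup>2 + (sqrt (1 - 1 / real m))\<^sup>2 = of_bool (m \<ge> 2)"
    using block_profile[OF assms(1)] by blast
  define x y t where "x = sqrt (1 - 1 / real n)" and "y = sqrt (1 - 1 / real m)"
    and "t = sqrt ((1 - 1 / real m) * (1 - 1 / real n))"
  have t: "t = x * y" "0 \<le> t"
    using assms by (simp_all add: t_def x_def y_def real_sqrt_mult)
  define g where "g = (\<lambda>v. if v < n then p else if v = n then - (x + y) else q)"
  have gA: "sum g A = x" "(\<Sum>v\<in>A. (g v)\<^sup>2) = real (n - 1) * p\<^sup>2"
    using p(1) by (simp_all add: A_def g_def x_def)
  have gB: "sum g B = y" "(\<Sum>v\<in>B. (g v)\<^sup>2) = real (m - 1) * q\<^sup>2"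
    using q(1) assms by (simp_all add: B_def g_def y_def)
  have g0: "inner_on V (\<lambda>_. 1) g = 0"
    by (simp add: inner_on_def split gA gB) (simp add: g_def)
  define c :: real where "c = of_bool (n \<ge> 2) + of_bool (m \<ge> 2)"
  have gN: "inner_on V g g = c + 2 * t"
    unfolding norm[OF g0] gA gB using p(2) q(2) t(1)
    by (simp add: c_def power2_sum flip: x_def y_def)
  have "c > 0"
    using assms by (simp add: c_def)
  \<comment> \<open>Two proper blocks give \<open>c = 2\<close>; if one of them is a single vertex, then \<open>t = 0\<close>.\<close>
  have ct: "c * t = 2 * t"
    using assms by (cases "n = 1 \<or> m = 1") (auto simp: c_def t_def)
  have "QEC ?G = - (1 / (1 + t))"
  proof (rule QEC_eqI[where g = g])
    fix f :: "nat \<Rightarrow> real"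
    assume "inner_on (verts ?G) (\<lambda>_. 1) f = 0"
    then have f: "inner_on V (\<lambda>_. 1) f = 0"
      unfolding verts .
    have "(sum f A)\<^sup>2 \<le> (1 - 1 / real n) * ((\<Sum>v\<in>A. (f v)\<^sup>2) + (sum f A)\<^sup>2)"
      using assms by (intro sum_squared_le_one_minus_inverse) (auto simp: A_def)
    moreover have "(sum f B)\<^sup>2 \<le> (1 - 1 / real m) * ((\<Sum>v\<in>B. (f v)\<^sup>2) + (sum f B)\<^sup>2)"
      using assms by (intro sum_squared_le_one_minus_inverse) (auto simp: B_def)
    ultimately show "inner_on (verts ?G) f (mat_apply (verts ?G) (dist_matrix ?G) f)
        \<le> - (1 / (1 + t)) * inner_on (verts ?G) f f"
      using star_product_bound[of "sum f A" "1 - 1 / real n" "\<Sum>v\<in>A. (f v)\<^sup>2"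
          "sum f B" "1 - 1 / real m" "\<Sum>v\<in>B. (f v)\<^sup>2"] assms
      unfolding verts form[OF f] norm[OF f] t_def
      by (simp add: mult.commute[of "1 - 1 / real n"] sum_nonneg)
  next
    show "inner_on (verts ?G) (\<lambda>_. 1) g = 0"
      unfolding verts by (rule g0)
    show "inner_on (verts ?G) g g > 0"
      unfolding verts gN using \<open>c > 0\<close> t(2) by simp
    have "- c = - (1 / (1 + t)) * (c + 2 * t)"
      using t(2) ct by (simp add: field_simps)
    then show "inner_on (verts ?G) g (mat_apply (verts ?G) (dist_matrix ?G) g)
        = - (1 / (1 + t)) * inner_on (verts ?G) g g"
      unfolding verts form[OF g0] gN gA gB by (simp add: t(1))
  qed
  then show ?thesis
    by (simp add: t_def)
qed

end
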